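(* Let $n\ge2$. The linear maps $$\iota_{M_n}:\widehat{\mathcal C}(M_n)\to\mathrm{span}\{\widehat{\rho_w}\mid w\in M_n\},\qquad \iota_{F_n}:\widehat{\mathcal C}(F_n)\to\mathrm{span}\{\widehat{\rho_w}\mid w\in F_n\},$$ which send a class $[f]$ to the homogenization $\widehat f$, are isomorphisms. In particular, $\widehat{\mathcal C}(M_n)$ and $\widehat{\mathcal C}(F_n)$ can be identified with the respective vector spaces spanned by cyclic counting functions.
   Context: Let $S=\{a_1,\dots,a_n\}$, $n\ge2$, and $\bar S=\{a_1,\dots,a_n,a_1^{-1},\dots,a_n^{-1}\}$. $M_n$ is the free monoid of all words over $S$ (including the empty word $e$); $F_n$ is the free group on $S$, viewed as the set of reduced words over $\bar S$. For $v=s_1\cdots s_l\neq e$ and $w=r_1\cdots r_m$ (words over $S$, resp. reduced words over $\bar S$), $\rho_v(w)$ is the number of $j\in\{0,\dots,m-l\}$ such that $s_i=r_{j+i}$ for all $i=1,\dots,l$ (it is $0$ if $l>m$). Also $\rho_e(w)$ is the length of $w$. $\mathcal C(M_n)$, $\mathcal C(F_n)$ are the real vector spaces of functions spanned by the counting functions $\rho_v$, $v\in M_n$, resp. $v\in F_n$; $\widehat{\mathcal C}(M_n)$, $\widehat{\mathcal C}(F_n)$ are their quotients by the subspace of bounded functions in them, and $[f]$ is the class of $f$. A real function $f$ on a monoid $M$ is homogenizable if $\widehat f(g)=\lim_{k\to\infty}f(g^k)/k$ exists for every $g\in M$; then $\widehat f$ is called its homogenization. Every element $f$ of $\mathcal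 C(M_n)$ or $\mathcal C(F_n)$ is homogenizable, and $\widehat f$ depends only on $[f]$, so the maps $\iota_{M_n},\iota_{F_n}$ are well defined. Cyclic counting functions: for an integer $k$ let $[k]_m$ be the element of $\{1,\dots,m\}$ congruent to $k$ modulo $m$. For $v=s_1\cdots s_l$ and $w=r_1\cdots r_m$ in $M_n$, $\widehat{\rho_v}(w)$ is the number of $j\in\{1,\dots,m\}$ with $s_i=r_{[j+i]_m}$ for all $i=1,\dots,l$. For $v\in F_n$ and $w\in F_n$, let $w_0$ be a cyclically reduced word conjugate to $w$; then $\widehat{\rho_v}(w)$ is the number of cyclic occurrences of $v$ in $w_0$, counted by the same formula with $w_0$ in place of $w$. The function $\widehat{\rho_v}$ is the homogenization of $\rho_v$. *)

theory Defs
  imports "HOL-Analysis.Analysis" "HOL-Library.Function_Algebras"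
begin

section \<open>The vector space of real functions on a type\<close>

instantiation "fun" :: (type, real_vector) real_vector
begin

definition scaleR_fun :: "real \<Rightarrow> ('a \<Rightarrow> 'b) \<Rightarrow> 'a \<Rightarrow> 'b" where
  "scaleR_fun c f = (\<lambda>x. c *\<^sub>R f x)"

instance
  by standard (auto simp: scaleR_fun_def fun_eq_iff algebra_simps)

end


section \<open>Homogenization\<close>

definition homogenizable :: "('m::monoid_mult \<Rightarrow> real) \<Rightarrow> bool" where
  "homogenizable f \<longleftrightarrow> (\<forall>g. convergent (\<lambda>k. f (g ^ k) / real k))"

definition homogenization :: "('m::monoid_mult \<Rightarrow> real) \<Rightarrow> 'm \<Rightarrow> real" where
  "homogenization f g = lim (\<lambda>k. f (g ^ k) / real k)"


section \<open>Counting occurrences in words\<close>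

text \<open>Positions in lists start at \<open>0\<close>, so both the offset \<open>j\<close> of a cyclic occurrence and the
  index \<open>i\<close> below are one less than for words whose letters are numbered from \<open>1\<close>.\<close>

definition occurrences :: "'b list \<Rightarrow> 'b list \<Rightarrow> nat" where
  "occurrences v w =
     (if v = [] then length w
      else card {j. j + length v \<le> length w \<and> (\<forall>i<length v. v ! i = w ! (j + i))})"

definition cyclic_occurrences :: "'b list \<Rightarrow> 'b list \<Rightarrow> nat" where
  "cyclic_occurrences v w =
     card {j. j < length w \<and> (\<forall>i<length v. v ! i = w ! ((j + i) mod length w))}"

text \<open>The class has exactly two intended instances, free monoids and free groups; it allows the
  spaces of counting functions to be introduced once for both.
  \<open>counting v\<close> is $\rho_v$ and \<open>cyclic_counting v\<close> is $\widehat{\rho_v}$.\<close>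

class word_monoid = monoid_mult +
  fixes counting :: "'a \<Rightarrow> 'a \<Rightarrow> real"
    and cyclic_counting :: "'a \<Rightarrow> 'a \<Rightarrow> real"


section \<open>Free monoids\<close>

text \<open>The free monoid on the type \<open>'a\<close> of generators is \<open>'a list\<close> with concatenation.\<close>

instantiation list :: (type) word_monoid
begin

definition one_list :: "'a list" where "1 = []"

definition times_list :: "'a list \<Rightarrow> 'a list \<Rightarrow> 'a list" where "u * v = u @ v"

definition counting_list :: "'a list \<Rightarrow> 'a list \<Rightarrow> real" where
  "counting v w = real (occurrences v w)"

definition cyclic_counting_list :: "'a list \<Rightarrow> 'a list \<Rightarrow> real" where
  "cyclic_counting v w = real (cyclic_occurrences v w)"

instance
  by standard (auto simp: one_list_def times_list_def)

end


section \<open>Free groups\<close>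

text \<open>The letter \<open>(a, True)\<close> stands for the generator \<open>a\<close> and \<open>(a, False)\<close> for its inverse.\<close>

definition inv_letter :: "'a \<times> bool \<Rightarrow> 'a \<times> bool" where
  "inv_letter x = (fst x, \<not> snd x)"

definition reduced :: "('a \<times> bool) list \<Rightarrow> bool" where
  "reduced w \<longleftrightarrow> successively (\<lambda>x y. y \<noteq> inv_letter x) w"

definition push :: "'a \<times> bool \<Rightarrow> ('a \<times> bool) list \<Rightarrow> ('a \<times> bool) list" where
  "push x w = (case w of [] \<Rightarrow> [x] | y # ys \<Rightarrow> if y = inv_letter x then ys else x # y # ys)"

definition reduce :: "('a \<times> bool) list \<Rightarrow> ('a \<times> bool) list" where
  "reduce w = foldr push w []"

definition inv_word :: "('a \<times> bool) list \<Rightarrow> ('a \<times> bool) list" where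
  "inv_word w = rev (map inv_letter w)"

lemma inv_letter_inv_letter [simp]: "inv_letter (inv_letter x) = x"
  by (simp add: inv_letter_def)

lemma inv_letter_neq [simp]: "inv_letter x \<noteq> x" "x \<noteq> inv_letter x"
  by (simp_all add: inv_letter_def prod_eq_iff)

lemma reduced_Nil [simp]: "reduced []"
  by (simp add: reduced_def)

lemma reduced_Cons: "reduced (x # w) \<longleftrightarrow> (w = [] \<or> hd w \<noteq> inv_letter x) \<and> reduced w"
  by (auto simp: reduced_def successively_Cons)

lemma reduced_push: "reduced w \<Longrightarrow> reduced (push x w)"
  by (auto simp: push_def reduced_Cons split: list.splits)

lemma reduced_foldr_push: "reduced w \<Longrightarrow> reduced (foldr push u w)"
  by (induction u) (auto intro: reduced_push)

lemma reduced_reduce [simp]: "reduced (reduce w)"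
  by (simp add: reduce_def reduced_foldr_push)

lemma push_inv_letter_push: "reduced w \<Longrightarrow> push (inv_letter x) (push x w) = w"
  by (auto simp: push_def reduced_Cons split: list.splits)

lemma push_push_inv_letter: "reduced w \<Longrightarrow> push x (push (inv_letter x) w) = w"
  using push_inv_letter_push[of w "inv_letter x"] by simp

lemma foldr_push_push:
  assumes "reduced u" "reduced w"
  shows "foldr push (push x u) w = push x (foldr push u w)"
proof (cases u)
  case Nil
  then show ?thesis by (simp add: push_def)
next
  case (Cons y ys)
  show ?thesis
  proof (cases "y = inv_letter x")
    case True
    then have "push x (push y (foldr push ys w)) = foldr push ys w"
      using push_push_inv_letter[OF reduced_foldr_push[OF assms(2)]] by simp
    then show ?thesis using Cons True by (simp add: push_def)
  next
    case False
    then show ?thesis using Cons by (simp add: push_def)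
  qed
qed

lemma foldr_push_reduce: "reduced w \<Longrightarrow> foldr push (reduce u) w = foldr push u w"
proof (induction u)
  case Nil
  then show ?case by (simp add: reduce_def)
next
  case (Cons x u)
  have "reduce (x # u) = push x (reduce u)"
    by (simp add: reduce_def)
  then show ?case
    using Cons foldr_push_push[of "reduce u" w x] by simp
qed

lemma reduce_reduced: "reduced w \<Longrightarrow> reduce w = w"
proof (induction w)
  case Nil
  then show ?case by (simp add: reduce_def)
next
  case (Cons x w)
  have "reduce (x # w) = push x (reduce w)"
    by (simp add: reduce_def)
  also have "\<dots> = push x w"
    using Cons by (simp add: reduced_Cons)
  also have "\<dots> = x # w"
    using Cons.prems by (auto simp: push_def reduced_Cons split: list.splits)
  finally show ?case .
qed

lemma reduce_append: "reduce (u @ v) = foldr push u (reduce v)"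
  by (simp add: reduce_def)

lemma reduce_reduce_append1: "reduce (reduce u @ v) = reduce (u @ v)"
  by (simp add: reduce_append foldr_push_reduce)

lemma reduce_reduce_append2: "reduce (u @ reduce v) = reduce (u @ v)"
  by (simp add: reduce_append reduce_reduced)

lemma reduce_inv_word_append: "reduce (inv_word u @ u @ v) = reduce v"
proof (induction u arbitrary: v)
  case Nil
  then show ?case by (simp add: inv_word_def)
next
  case (Cons x u)
  have "reduce (inv_word (x # u) @ (x # u) @ v)
      = foldr push (inv_word u) (push (inv_letter x) (push x (reduce (u @ v))))"
    by (simp add: inv_word_def reduce_def)
  also have "\<dots> = reduce (inv_word u @ u @ v)"
    by (subst push_inv_letter_push) (simp_all add: reduce_def reduced_foldr_push)
  finally show ?case using Cons by simp
qed

typedef 'a free_group = "{w :: ('a \<times> bool) list. reduced w}"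
  morphisms word_of Abs_free_group
  by (rule exI[of _ "[]"]) simp

setup_lifting type_definition_free_group

definition cyclically_reduced :: "'a free_group \<Rightarrow> bool" where
  "cyclically_reduced g \<longleftrightarrow>
     word_of g = [] \<or> hd (word_of g) \<noteq> inv_letter (last (word_of g))"

instantiation free_group :: (type) "{monoid_mult, inverse}"
begin

lift_definition one_free_group :: "'a free_group" is "[]"
  by simp

lift_definition times_free_group :: "'a free_group \<Rightarrow> 'a free_group \<Rightarrow> 'a free_group"
  is "\<lambda>u v. reduce (u @ v)"
  by simp

lift_definition inverse_free_group :: "'a free_group \<Rightarrow> 'a free_group"
  is "\<lambda>u. reduce (inv_word u)"
  by simp

definition divide_free_group :: "'a free_group \<Rightarrow> 'a free_group \<Rightarrow> 'a free_group" where
  "divide_free_group g h = g * inverse h"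

instance
proof
  fix a b c :: "'a free_group"
  show "a * b * c = a * (b * c)"
    by transfer (simp add: reduce_reduce_append1 reduce_reduce_append2)
  show "1 * a = a" "a * 1 = a"
    by (transfer; simp add: reduce_reduced)+
qed

end

lemma free_group_left_inverse: "inverse g * g = (1 :: 'a free_group)"
proof transfer
  fix u :: "('a \<times> bool) list"
  show "reduce (reduce (inv_word u) @ u) = []"
    using reduce_inv_word_append[of u "[]"]
    by (simp add: reduce_reduce_append1) (simp add: reduce_def)
qed

definition conjugate :: "'a free_group \<Rightarrow> 'a free_group \<Rightarrow> bool" where
  "conjugate g h \<longleftrightarrow> (\<exists>x. h = inverse x * g * x)"

lemma ex_cyclically_reduced_conjugate: "\<exists>h. cyclically_reduced h \<and> conjugate g h"
proof (induction "length (word_of g)" arbitrary: g rule: less_induct)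
  case less
  show ?case
  proof (cases "cyclically_reduced g")
    case True
    have "g = inverse 1 * g * 1"
      using free_group_left_inverse[of "1 :: 'a free_group"] by simp
    then show ?thesis using True unfolding conjugate_def by blast
  next
    case False
    then obtain x u where xu: "word_of g = x # u"
      by (cases "word_of g") (auto simp: cyclically_reduced_def)
    with False have u: "u \<noteq> []" and "last u = inv_letter x"
      by (auto simp: cyclically_reduced_def split: if_splits)
    then obtain v where v: "u = v @ [inv_letter x]"
      by (metis append_butlast_last_id)
    have red: "reduced (x # v @ [inv_letter x])"
      using word_of[of g] xu v by simp
    then have "reduced v"
      by (auto simp: reduced_def successively_Cons successively_append_iff)
    define h where "h = Abs_free_group v"
    define y where "y = Abs_free_group [x]"
    have wh: "word_of h = v" and wy: "word_of y = [x]"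
      using \<open>reduced v\<close> by (auto simp: h_def y_def Abs_free_group_inverse reduced_def)
    have iy: "word_of (inverse y) = [inv_letter x]"
      by (simp add: inverse_free_group.rep_eq wy inv_word_def reduce_def push_def)
    have gy: "g = y * h * inverse y"
      using red by (simp add: word_of_inject[symmetric] times_free_group.rep_eq wh wy iy
          reduce_reduce_append1 reduce_reduced xu v)
    have "inverse y * g * y = (inverse y * y) * h * (inverse y * y)"
      by (simp only: gy mult.assoc)
    then have hg: "h = inverse y * g * y"
      by (simp add: free_group_left_inverse)
    have "length (word_of h) < length (word_of g)"
      by (simp add: wh xu v)
    then obtain k z where k: "cyclically_reduced k" "k = inverse z * h * z"
      using less unfolding conjugate_def by blast
    have inv_mult: "inverse (y * z) = inverse z * inverse y"
    proof -
      have *: "y * z * inverse (y * z) = 1"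
        using free_group_left_inverse
        by (metis mult.assoc mult_1_left)
      have "inverse z * inverse y = inverse z * inverse y * (y * z * inverse (y * z))"
        by (simp add: *)
      also have "\<dots> = inverse z * (inverse y * y) * z * inverse (y * z)"
        by (simp only: mult.assoc)
      finally show ?thesis by (simp add: free_group_left_inverse)
    qed
    have "k = inverse (y * z) * g * (y * z)"
      by (simp add: k(2) hg inv_mult mult.assoc)
    with k(1) show ?thesis unfolding conjugate_def by blast
  qed
qed

text \<open>The cyclically reduced conjugate is unique only up to cyclic rotation, which does not affect
  the number of cyclic occurrences.\<close>

definition cyclic_core :: "'a free_group \<Rightarrow> 'a free_group" where
  "cyclic_core w = (SOME w0. cyclically_reduced w0 \<and> conjugate w w0)"

instantiation free_group :: (type) word_monoid
begin

definition counting_free_group :: "'a free_group \<Rightarrow> 'a free_group \<Rightarrow> real" where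
  "counting v w = real (occurrences (word_of v) (word_of w))"

definition cyclic_counting_free_group :: "'a free_group \<Rightarrow> 'a free_group \<Rightarrow> real" where
  "cyclic_counting v w = real (cyclic_occurrences (word_of v) (word_of (cyclic_core w)))"

instance ..

end


section \<open>Counting functions modulo bounded functions\<close>

definition counting_space :: "('m::word_monoid \<Rightarrow> real) set" where
  "counting_space = span (range counting)"

definition cyclic_counting_space :: "('m::word_monoid \<Rightarrow> real) set" where
  "cyclic_counting_space = span (range cyclic_counting)"

definition counting_equiv :: "('m::word_monoid \<Rightarrow> real) \<Rightarrow> ('m \<Rightarrow> real) \<Rightarrow> bool" where
  "counting_equiv f h \<longleftrightarrow>
     f \<in> counting_space \<and> h \<in> counting_space \<and> bounded (range (f - h))"

lemma bounded_range_real: "bounded (range f) \<longleftrightarrow> (\<exists>K. \<forall>x. \<bar>f x\<bar> \<le> (K::real))"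
  by (auto simp: bounded_iff)

lemma bounded_range_fun_add:
  "bounded (range f) \<Longrightarrow> bounded (range h) \<Longrightarrow> bounded (range (f + h :: 'm \<Rightarrow> real))"
  unfolding bounded_range_real plus_fun_def by (meson abs_triangle_ineq add_mono order_trans)

lemma bounded_range_fun_scaleR:
  "bounded (range f) \<Longrightarrow> bounded (range (c *\<^sub>R f :: 'm \<Rightarrow> real))"
  unfolding bounded_range_real scaleR_fun_def
  by (auto simp: abs_mult) (meson abs_ge_zero mult_left_mono)

quotient_type (overloaded) 'm counting_quotient =
  "'m::word_monoid \<Rightarrow> real" / partial: counting_equiv
  morphisms rep_counting_quotient counting_class
proof (rule part_equivpI)
  show "\<exists>f :: 'm \<Rightarrow> real. counting_equiv f f"
    by (rule exI[of _ 0])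
       (auto simp: counting_equiv_def counting_space_def span_zero bounded_range_real)
  show "symp (counting_equiv :: ('m \<Rightarrow> real) \<Rightarrow> _)"
    by (rule sympI) (auto simp: counting_equiv_def bounded_range_real abs_minus_commute)
  show "transp (counting_equiv :: ('m \<Rightarrow> real) \<Rightarrow> _)"
  proof (rule transpI)
    fix f g h :: "'m \<Rightarrow> real"
    assume "counting_equiv f g" "counting_equiv g h"
    then show "counting_equiv f h"
      using bounded_range_fun_add[of "f - g" "g - h"] by (simp add: counting_equiv_def)
  qed
qed

instantiation counting_quotient :: (word_monoid) real_vector
begin

lift_definition zero_counting_quotient :: "'a counting_quotient" is 0
  by (auto simp: counting_equiv_def counting_space_def span_zero bounded_range_real)

lift_definition plus_counting_quotient ::
  "'a counting_quotient \<Rightarrow> 'a counting_quotient \<Rightarrow> 'a counting_quotient" is "(+)"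
proof -
  fix f f' h h' :: "'a \<Rightarrow> real"
  assume "counting_equiv f f'" "counting_equiv h h'"
  then show "counting_equiv (f + h) (f' + h')"
    using bounded_range_fun_add[of "f - f'" "h - h'"]
    by (auto simp: counting_equiv_def counting_space_def span_add algebra_simps)
qed

lift_definition scaleR_counting_quotient ::
  "real \<Rightarrow> 'a counting_quotient \<Rightarrow> 'a counting_quotient" is "scaleR"
proof -
  fix c :: real and f f' :: "'a \<Rightarrow> real"
  assume "counting_equiv f f'"
  then show "counting_equiv (c *\<^sub>R f) (c *\<^sub>R f')"
    using bounded_range_fun_scaleR[of "f - f'" c]
    by (auto simp: counting_equiv_def counting_space_def span_scale scaleR_diff_right)
qed

lift_definition uminus_counting_quotient :: "'a counting_quotient \<Rightarrow> 'a counting_quotient"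
  is uminus
proof -
  fix f f' :: "'a \<Rightarrow> real"
  assume "counting_equiv f f'"
  then show "counting_equiv (- f) (- f')"
    using bounded_range_fun_scaleR[of "f - f'" "-1"]
    by (auto simp: counting_equiv_def counting_space_def span_neg)
qed

lift_definition minus_counting_quotient ::
  "'a counting_quotient \<Rightarrow> 'a counting_quotient \<Rightarrow> 'a counting_quotient" is "(-)"
proof -
  fix f f' h h' :: "'a \<Rightarrow> real"
  assume "counting_equiv f f'" "counting_equiv h h'"
  then show "counting_equiv (f - h) (f' - h')"
    using bounded_range_fun_add[of "f - f'" "(-1) *\<^sub>R (h - h')"]
      bounded_range_fun_scaleR[of "h - h'" "-1"]
    by (auto simp: counting_equiv_def counting_space_def span_diff algebra_simps)
qed

instance
proof
  fix a b c :: "'a counting_quotient" and x y :: real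
  have equiv_span: "counting_equiv f f \<longleftrightarrow> f \<in> span (range counting)" for f :: "'a \<Rightarrow> real"
    by (auto simp: counting_equiv_def counting_space_def bounded_range_real)
  note simps = equiv_span span_add span_scale span_zero
  show "a + b + c = a + (b + c)"
    by transfer (simp add: simps add.assoc)
  show "a + b = b + a"
    by transfer (simp add: simps add.commute)
  show "0 + a = a"
    by transfer (simp add: simps)
  show "- a + a = 0"
    by transfer (simp add: simps)
  show "a - b = a + - b"
    by transfer (simp add: simps span_diff span_neg)
  show "x *\<^sub>R (a + b) = x *\<^sub>R a + x *\<^sub>R b"
    by transfer (simp add: simps scaleR_add_right)
  show "(x + y) *\<^sub>R a = x *\<^sub>R a + y *\<^sub>R a"
    by transfer (simp add: simps scaleR_add_left)
  show "x *\<^sub>R y *\<^sub>R a = (x * y) *\<^sub>R a"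
    by transfer (simp add: simps)
  show "1 *\<^sub>R a = a"
    by transfer (simp add: simps)
qed

end

lemma homogenization_cong_bounded:
  fixes f h :: "'m::monoid_mult \<Rightarrow> real"
  assumes "bounded (range (f - h))"
  shows "homogenization f = homogenization h"
proof
  fix g :: 'm
  obtain K where K: "\<bar>f x - h x\<bar> \<le> K" for x
    using assms by (auto simp: bounded_range_real)
  have "(\<lambda>k. K / real k) \<longlonglongrightarrow> 0"
    by (rule lim_const_over_n)
  then have "(\<lambda>k. (f (g ^ k) - h (g ^ k)) / real k) \<longlonglongrightarrow> 0"
    by (rule Lim_null_comparison[rotated])
       (auto intro!: always_eventually divide_right_mono K simp: abs_divide)
  then have "(\<lambda>k. f (g ^ k) / real k - h (g ^ k) / real k) \<longlonglongrightarrow> 0"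
    by (simp add: diff_divide_distrib)
  then have "((\<lambda>k. f (g ^ k) / real k) \<longlonglongrightarrow> L) \<longleftrightarrow> ((\<lambda>k. h (g ^ k) / real k) \<longlonglongrightarrow> L)" for L
    by (rule Lim_transform_eq)
  then show "homogenization f g = homogenization h g"
    by (simp add: homogenization_def lim_def)
qed

lift_definition homogenization_map :: "'m::word_monoid counting_quotient \<Rightarrow> 'm \<Rightarrow> real"
  is homogenization
  by (rule homogenization_cong_bounded) (simp add: counting_equiv_def)

end

theory Submission
  imports Defs
begin

text \<open>
  Surjectivity onto the span of the cyclic counting functions is formal once the homogenization of
  each \<open>counting v\<close> is known to be \<open>cyclic_counting v\<close>.  The content is injectivity: a function in
  the counting space whose homogenization vanishes must be bounded.

  The reason is that a word and the cyclic word obtained by joining its ends contain \<open>v\<close> equally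
  often, up to the at most \<open>length v\<close> occurrences running across the joint.  In a free monoid every
  word can be closed up in this way, so every \<open>f\<close> in the counting space differs from its
  homogenization by a bounded function.  In a free group only the cyclically reduced words can be
  closed up without cancellation; but as there are at least four letters, one letter can be appended
  to any reduced word to make it cyclically reduced, at the cost of changing each count by at most
  one.  So in both cases there is a map \<open>c\<close> (the identity, or the appending of such a letter) for
  which \<open>f - homogenization f \<circ> c\<close> is bounded for all \<open>f\<close> in the counting space, and
  injectivity follows at once.  The lemma \<open>homogenization_map_iso\<close> carries this out for both
  cases simultaneously.

  The homogenization of \<open>counting v\<close> is computed by the same comparison, applied to powers: the
  cyclic count is exactly multiplicative on powers.  In the free group, a power of \<open>g\<close> is
  conjugate, by an element independent of the exponent, to the power of a cyclically reduced
  element, and multiplication by a fixed element changes counts by a bounded amount.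
\<close>

section \<open>Occurrences in words\<close>

lemma finite_occurrences:
  "v \<noteq> [] \<Longrightarrow> finite {j. j + length v \<le> length w \<and> (\<forall>i<length v. v ! i = w ! (j + i))}"
  by (rule finite_subset[of _ "{..length w}"]) auto

lemma occurrences_Cons:
  "occurrences v w \<le> occurrences v (x # w) \<and> occurrences v (x # w) \<le> Suc (occurrences v w)"
proof (cases "v = []")
  case True
  then show ?thesis by (simp add: occurrences_def)
next
  case False
  define A where "A u = {j. j + length v \<le> length u \<and> (\<forall>i<length v. v ! i = u ! (j + i))}" for u
  have fin: "finite (A u)" for u
    unfolding A_def by (rule finite_occurrences[OF False])
  have sub1: "Suc ` A w \<subseteq> A (x # w)"
    by (auto simp: A_def)
  have sub2: "A (x # w) \<subseteq> insert 0 (Suc ` A w)"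
  proof
    fix j assume "j \<in> A (x # w)"
    then show "j \<in> insert 0 (Suc ` A w)"
      by (cases j) (auto simp: A_def)
  qed
  have "card (A w) \<le> card (A (x # w))"
    using card_mono[OF fin sub1] by (simp add: card_image)
  moreover have "card (A (x # w)) \<le> Suc (card (A w))"
    using card_mono[OF _ sub2] fin[of w] card_insert_le_m1[of "Suc (card (A w))" "Suc ` A w" 0]
    by (simp add: card_image)
  ultimately show ?thesis
    using False by (simp add: occurrences_def A_def)
qed

lemma occurrences_snoc:
  "occurrences v w \<le> occurrences v (w @ [x]) \<and> occurrences v (w @ [x]) \<le> Suc (occurrences v w)"
proof (cases "v = []")
  case True
  then show ?thesis by (simp add: occurrences_def)
next
  case False
  define A where "A u = {j. j + length v \<le> length u \<and> (\<forall>i<length v. v ! i = u ! (j + i))}" for u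
  have fin: "finite (A u)" for u
    unfolding A_def by (rule finite_occurrences[OF False])
  have sub1: "A w \<subseteq> A (w @ [x])"
    by (auto simp: A_def nth_append)
  have sub2: "A (w @ [x]) \<subseteq> insert (Suc (length w) - length v) (A w)"
  proof
    fix j assume j: "j \<in> A (w @ [x])"
    show "j \<in> insert (Suc (length w) - length v) (A w)"
    proof (cases "j + length v = Suc (length w)")
      case True
      then have "j = Suc (length w) - length v" by simp
      then show ?thesis by simp
    next
      case False
      then show ?thesis using j by (auto simp: A_def nth_append)
    qed
  qed
  have "card (A w) \<le> card (A (w @ [x]))"
    using card_mono[OF fin sub1] .
  moreover have "card (A (w @ [x])) \<le> Suc (card (A w))"
    using card_mono[OF _ sub2] fin[of w]
      card_insert_le_m1[of "Suc (card (A w))" "A w" "Suc (length w) - length v"] by simp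
  ultimately show ?thesis
    using False by (simp add: occurrences_def A_def)
qed

text \<open>Only the occurrences that run across the joint of the cyclic word distinguish the two counts,
  and these start among the last \<open>length v - 1\<close> positions.\<close>

lemma occurrences_cyclic_occurrences:
  "\<bar>real (occurrences v w) - real (cyclic_occurrences v w)\<bar> \<le> real (length v)"
proof (cases "v = []")
  case True
  then show ?thesis by (simp add: occurrences_def cyclic_occurrences_def)
next
  case False
  define A where "A = {j. j + length v \<le> length w \<and> (\<forall>i<length v. v ! i = w ! (j + i))}"
  define B where
    "B = {j. j < length w \<and> (\<forall>i<length v. v ! i = w ! ((j + i) mod length w))}"
  define C where "C = {Suc (length w) - length v..<length w}"
  have fin: "finite A" "finite B" "finite C"
    using finite_occurrences[OF False] by (simp_all add: A_def B_def C_def)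
  have "A \<subseteq> B"
  proof
    fix j assume j: "j \<in> A"
    have "j < length w" using j False by (cases v) (simp_all add: A_def)
    then show "j \<in> B" using j by (simp add: A_def B_def)
  qed
  then have "card A \<le> card B"
    using fin by (simp add: card_mono)
  moreover have "B \<subseteq> A \<union> C"
  proof
    fix j assume j: "j \<in> B"
    show "j \<in> A \<union> C"
    proof (cases "j + length v \<le> length w")
      case True
      then have "(j + i) mod length w = j + i" if "i < length v" for i
        using that by simp
      then show ?thesis using j True by (simp add: A_def B_def)
    next
      case False
      then show ?thesis using j by (auto simp: B_def C_def)
    qed
  qed
  then have "card B \<le> card A + card C"
    using fin card_mono[of "A \<union> C" B] card_Un_le[of A C] by simp
  moreover have "card C \<le> length v"
    by (simp add: C_def)
  ultimately have "\<bar>real (card A) - real (card B)\<bar> \<le> real (length v)"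
    by linarith
  then show ?thesis
    using False by (simp add: occurrences_def cyclic_occurrences_def A_def B_def)
qed

lemma nth_concat_replicate:
  "j < k * length w \<Longrightarrow> concat (replicate k w) ! j = w ! (j mod length w)"
proof (induction k arbitrary: j)
  case 0
  then show ?case by simp
next
  case (Suc k)
  show ?case
  proof (cases "j < length w")
    case True
    then show ?thesis by (simp add: nth_append)
  next
    case False
    then have "(j - length w) mod length w = j mod length w"
      by (simp add: le_mod_geq)
    then show ?thesis
      using False Suc by (simp add: nth_append)
  qed
qed

lemma card_periodic:
  "card {j. j < k * m \<and> P (j mod m)} = k * card {j. j < m \<and> P j}" for m :: nat
proof (induction k)
  case 0
  then show ?case by simp
next
  case (Suc k)
  let ?B = "{j. j < m \<and> P j}"
  have eq: "{j. j < Suc k * m \<and> P (j mod m)}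
      = {j. j < k * m \<and> P (j mod m)} \<union> (\<lambda>j. j + k * m) ` ?B" (is "?L = ?A \<union> ?C")
  proof (intro equalityI subsetI)
    fix j assume j: "j \<in> ?L"
    show "j \<in> ?A \<union> ?C"
    proof (cases "j < k * m")
      case True
      then show ?thesis using j by simp
    next
      case False
      define i where "i = j - k * m"
      have ji: "j = i + k * m" using False by (simp add: i_def)
      then have "i < m" "P i" using j by auto
      then show ?thesis using ji by blast
    qed
  qed auto
  have "?A \<inter> ?C = {}" by auto
  then have "card (?A \<union> ?C) = card ?A + card ?C"
    by (intro card_Un_disjoint) auto
  also have "card ?C = card ?B"
    by (intro card_image) (simp add: inj_on_def)
  finally show ?case using Suc eq by simp
qed

lemma cyclic_occurrences_power:
  "cyclic_occurrences v (concat (replicate k w)) = k * cyclic_occurrences v w"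
proof -
  let ?m = "length w"
  let ?P = "\<lambda>j. \<forall>i<length v. v ! i = w ! ((j + i) mod ?m)"
  have len: "length (concat (replicate k w)) = k * ?m"
    by (simp add: length_concat sum_list_replicate)
  have "concat (replicate k w) ! ((j + i) mod (k * ?m)) = w ! ((j mod ?m + i) mod ?m)"
    if "j < k * ?m" for i j
  proof -
    have "concat (replicate k w) ! ((j + i) mod (k * ?m)) = w ! ((j + i) mod (k * ?m) mod ?m)"
      using that by (intro nth_concat_replicate mod_less_divisor) linarith
    also have "(j + i) mod (k * ?m) mod ?m = (j + i) mod ?m"
      by (simp add: mod_mod_cancel)
    finally show ?thesis by (simp add: mod_add_left_eq)
  qed
  then have "{j. j < k * ?m \<and>
        (\<forall>i<length v. v ! i = concat (replicate k w) ! ((j + i) mod (k * ?m)))}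
      = {j. j < k * ?m \<and> ?P (j mod ?m)}"
    by auto
  then show ?thesis
    using card_periodic[of k ?m ?P] by (simp add: cyclic_occurrences_def len)
qed

section \<open>From counting functions to their spans\<close>

lemma tendsto_slope:
  fixes u :: "nat \<Rightarrow> real"
  assumes "\<And>k. \<bar>u k - real k * c\<bar> \<le> K"
  shows "(\<lambda>k. u k / real k) \<longlonglongrightarrow> c"
proof -
  have "(\<lambda>k. u k / real k - c) \<longlonglongrightarrow> 0"
  proof (rule Lim_null_comparison[OF _ lim_const_over_n])
    show "\<forall>\<^sub>F k in sequentially. norm (u k / real k - c) \<le> K / real k"
      using eventually_gt_at_top[of 0]
    proof eventually_elim
      case (elim k)
      then have "u k / real k - c = (u k - real k * c) / real k"
        by (simp add: field_simps)
      then show ?case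
        using assms[of k] elim by (simp add: divide_right_mono)
    qed
  qed
  then show ?thesis by (simp add: LIM_zero_iff)
qed

lemma counting_class_surj:
  obtains f where "f \<in> counting_space" "a = counting_class f"
  using Quotient_abs_rep[OF Quotient_counting_quotient, of a]
    Quotient_rep_reflp[OF Quotient_counting_quotient, of a]
  by (auto simp: counting_equiv_def)

lemma counting_equiv_refl: "f \<in> counting_space \<Longrightarrow> counting_equiv f f"
  by (auto simp: counting_equiv_def bounded_range_real)

text \<open>
  The hypothesis \<open>close\<close> says that cyclic counts evaluated at \<open>c w\<close> agree with ordinary counts at \<open>w\<close>
  up to a bound depending on \<open>v\<close> alone.  It passes from the counting functions to their linear
  combinations, so that \<open>f w\<close> and \<open>homogenization f (c w)\<close> stay at bounded distance; if the
  homogenization is zero, then \<open>f\<close> is bounded.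
\<close>

lemma homogenization_map_iso:
  fixes c :: "'m::word_monoid \<Rightarrow> 'm"
  assumes lim: "\<And>v g :: 'm. (\<lambda>k. counting v (g ^ k) / real k) \<longlonglongrightarrow> cyclic_counting v g"
    and close: "\<And>v :: 'm. \<exists>K. \<forall>w. \<bar>counting v w - cyclic_counting v (c w)\<bar> \<le> K"
  shows "(\<forall>f \<in> (counting_space :: ('m \<Rightarrow> real) set).
        homogenizable f \<and> homogenization_map (counting_class f) = homogenization f)
     \<and> linear (homogenization_map :: 'm counting_quotient \<Rightarrow> 'm \<Rightarrow> real)
     \<and> bij_betw (homogenization_map :: 'm counting_quotient \<Rightarrow> 'm \<Rightarrow> real)
         UNIV cyclic_counting_space"
proof -
  let ?H = "homogenization_map :: 'm counting_quotient \<Rightarrow> 'm \<Rightarrow> real"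
  have lim_span: "(\<lambda>k. f (g ^ k) / real k) \<longlonglongrightarrow> homogenization f g"
    if "f \<in> counting_space" for f :: "'m \<Rightarrow> real" and g
  proof -
    from that have "convergent (\<lambda>k. f (g ^ k) / real k)"
      unfolding counting_space_def
    proof (induction rule: span_induct_alt)
      case base
      then show ?case by (simp add: convergent_const)
    next
      case (step a v f)
      then obtain u where "v = counting u" by auto
      then have "convergent (\<lambda>k. v (g ^ k) / real k)"
        using lim[of u g] by (auto simp: convergent_def)
      then have "convergent (\<lambda>k. a * (v (g ^ k) / real k) + f (g ^ k) / real k)"
        using step by (intro convergent_add convergent_mult convergent_const)
      then show ?case
        by (simp add: plus_fun_def scaleR_fun_def add_divide_distrib)
    qed
    then show ?thesis
      by (simp add: homogenization_def convergent_LIMSEQ_iff)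
  qed
  have hom_counting: "homogenization (counting v) = cyclic_counting v" for v :: 'm
    using lim[of v] by (auto simp: homogenization_def limI)
  have hom_add: "homogenization (f + h) = homogenization f + homogenization h"
    if "f \<in> counting_space" "h \<in> counting_space" for f h :: "'m \<Rightarrow> real"
  proof
    fix g
    have "(\<lambda>k. (f + h) (g ^ k) / real k) \<longlonglongrightarrow> homogenization f g + homogenization h g"
      using tendsto_add[OF lim_span[OF that(1)] lim_span[OF that(2)], of g g]
      by (simp add: plus_fun_def add_divide_distrib)
    then show "homogenization (f + h) g = (homogenization f + homogenization h) g"
      by (simp add: homogenization_def limI plus_fun_def)
  qed
  have hom_scale: "homogenization (a *\<^sub>R f) = a *\<^sub>R homogenization f"
    if "f \<in> counting_space" for a and f :: "'m \<Rightarrow> real"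
  proof
    fix g
    have "(\<lambda>k. (a *\<^sub>R f) (g ^ k) / real k) \<longlonglongrightarrow> a * homogenization f g"
      using tendsto_mult_left[OF lim_span[OF that, of g], of a] by (simp add: scaleR_fun_def)
    then show "homogenization (a *\<^sub>R f) g = (a *\<^sub>R homogenization f) g"
      by (simp add: homogenization_def limI scaleR_fun_def)
  qed
  have map_class: "?H (counting_class f) = homogenization f"
    if "f \<in> counting_space" for f :: "'m \<Rightarrow> real"
    using counting_equiv_refl[OF that] by (rule homogenization_map.abs_eq)
  have near: "\<exists>K. \<forall>w. \<bar>f w - homogenization f (c w)\<bar> \<le> K"
    if "f \<in> counting_space" for f :: "'m \<Rightarrow> real"
  proof -
    from that have "f \<in> counting_space \<and> (\<exists>K. \<forall>w. \<bar>f w - homogenization f (c w)\<bar> \<le> K)"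
      unfolding counting_space_def
    proof (induction rule: span_induct_alt)
      case base
      have "homogenization (0 :: 'm \<Rightarrow> real) = 0"
        by (simp add: homogenization_def fun_eq_iff)
      then have "\<forall>w. \<bar>(0 :: 'm \<Rightarrow> real) w - homogenization (0 :: 'm \<Rightarrow> real) (c w)\<bar> \<le> 0"
        by simp
      then show ?case using span_zero by blast
    next
      case (step a v f)
      then obtain u where v: "v = counting u" by auto
      have v_in: "v \<in> counting_space" and f_in: "f \<in> counting_space"
        using step v by (auto simp: counting_space_def span_base)
      have av_in: "a *\<^sub>R v \<in> counting_space"
        using v_in by (simp add: counting_space_def span_scale)
      obtain K where K: "\<bar>v w - homogenization v (c w)\<bar> \<le> K" for w
        using close[of u] by (auto simp: v hom_counting)
      obtain L where L: "\<bar>f w - homogenization f (c w)\<bar> \<le> L" for w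
        using step by auto
      have "\<bar>(a *\<^sub>R v + f) w - homogenization (a *\<^sub>R v + f) (c w)\<bar> \<le> \<bar>a\<bar> * K + L" for w
      proof -
        have "(a *\<^sub>R v + f) w - homogenization (a *\<^sub>R v + f) (c w)
            = a * (v w - homogenization v (c w)) + (f w - homogenization f (c w))"
          unfolding hom_add[OF av_in f_in] hom_scale[OF v_in]
          by (simp add: plus_fun_def scaleR_fun_def algebra_simps)
        also have "\<bar>\<dots>\<bar> \<le> \<bar>a\<bar> * \<bar>v w - homogenization v (c w)\<bar> + \<bar>f w - homogenization f (c w)\<bar>"
          by (metis abs_mult abs_triangle_ineq)
        also have "\<dots> \<le> \<bar>a\<bar> * K + L"
          using K L by (intro add_mono mult_left_mono) auto
        finally show ?thesis .
      qed
      then show ?case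
        using span_add[OF av_in[unfolded counting_space_def] f_in[unfolded counting_space_def]]
        by blast
    qed
    then show ?thesis by simp
  qed
  have lin: "linear ?H"
  proof (rule linearI)
    fix a b :: "'m counting_quotient"
    obtain f h where f: "f \<in> counting_space" "a = counting_class f"
      and h: "h \<in> counting_space" "b = counting_class h"
      by (metis counting_class_surj)
    have "a + b = counting_class (f + h)"
      using f h by (simp add: plus_counting_quotient.abs_eq counting_equiv_refl)
    moreover have "f + h \<in> counting_space"
      using f h by (simp add: counting_space_def span_add)
    ultimately show "?H (a + b) = ?H a + ?H b"
      using f h by (simp add: map_class hom_add)
  next
    fix r :: real and a :: "'m counting_quotient"
    obtain f where f: "f \<in> counting_space" "a = counting_class f"
      by (rule counting_class_surj)
    have "r *\<^sub>R a = counting_class (r *\<^sub>R f)"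
      using f by (simp add: scaleR_counting_quotient.abs_eq counting_equiv_refl)
    moreover have "r *\<^sub>R f \<in> counting_space"
      using f by (simp add: counting_space_def span_scale)
    ultimately show "?H (r *\<^sub>R a) = r *\<^sub>R ?H a"
      using f by (simp add: map_class hom_scale)
  qed
  have "inj ?H"
    unfolding linear_injective_0[OF lin]
  proof (intro allI impI)
    fix a :: "'m counting_quotient"
    assume zero: "?H a = 0"
    obtain f where f: "f \<in> counting_space" "a = counting_class f"
      by (rule counting_class_surj)
    then have "homogenization f = 0"
      using zero map_class by simp
    then have "counting_equiv f 0"
      using near[OF f(1)] f(1)
      by (simp add: counting_equiv_def bounded_range_real counting_space_def span_zero)
    then show "a = 0"
      using f Quotient_rel_abs[OF Quotient_counting_quotient, of f 0]
      by (simp add: zero_counting_quotient_def)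
  qed
  moreover have "range ?H = cyclic_counting_space"
  proof -
    \<comment> \<open>The classes of the counting functions span the quotient, and linear maps preserve spans.\<close>
    have cls: "counting_class f \<in> span (range (\<lambda>v. counting_class (counting v)))"
      if "f \<in> counting_space" for f :: "'m \<Rightarrow> real"
    proof -
      from that have "f \<in> counting_space \<and>
          counting_class f \<in> span (range (\<lambda>v. counting_class (counting v)))"
        unfolding counting_space_def
      proof (induction rule: span_induct_alt)
        case base
        have "counting_class 0 = (0 :: 'm counting_quotient)"
          by (simp add: zero_counting_quotient_def)
        then have "counting_class 0 \<in> span (range (\<lambda>v :: 'm. counting_class (counting v)))"
          by (metis span_zero)
        then show ?case using span_zero by blast
      next
        case (step a v f)
        have in_space: "v \<in> counting_space" "a *\<^sub>R v \<in> counting_space" "f \<in> counting_space"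
          using step by (auto simp: counting_space_def span_base span_scale)
        then have "counting_class (a *\<^sub>R v + f) = a *\<^sub>R counting_class v + counting_class f"
          by (simp add: plus_counting_quotient.abs_eq scaleR_counting_quotient.abs_eq
              counting_equiv_refl)
        moreover have "counting_class v \<in> span (range (\<lambda>v. counting_class (counting v)))"
          using step by (auto intro: span_base)
        ultimately have "counting_class (a *\<^sub>R v + f)
            \<in> span (range (\<lambda>v. counting_class (counting v)))"
          using step by (metis span_add span_scale)
        moreover have "a *\<^sub>R v + f \<in> span (range counting)"
          using in_space unfolding counting_space_def by (metis span_add)
        ultimately show ?case by blast
      qed
      then show ?thesis by simp
    qed
    have "UNIV = span (range (\<lambda>v :: 'm. counting_class (counting v)))"
      using cls by (metis UNIV_eq_I counting_class_surj)
    then have "range ?H = span (?H ` range (\<lambda>v :: 'm. counting_class (counting v)))"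
      by (metis linear_span_image[OF lin])
    also have "?H ` range (\<lambda>v :: 'm. counting_class (counting v)) = range cyclic_counting"
      by (simp add: image_image map_class counting_space_def span_base hom_counting)
    finally show ?thesis by (simp add: cyclic_counting_space_def)
  qed
  moreover have "homogenizable f" if "f \<in> counting_space" for f :: "'m \<Rightarrow> real"
    using lim_span[OF that] unfolding homogenizable_def convergent_def by blast
  ultimately show ?thesis
    using lin map_class by (simp add: bij_betw_def)
qed

section \<open>Free monoids\<close>

lemma power_list: "(w :: 'a list) ^ k = concat (replicate k w)"
  by (induction k) (simp_all add: one_list_def times_list_def)

lemma tendsto_counting_list:
  "(\<lambda>k. counting v (w ^ k) / real k) \<longlonglongrightarrow> cyclic_counting v w" for v w :: "'a list"
proof (rule tendsto_slope)
  show "\<bar>counting v (w ^ k) - real k * cyclic_counting v w\<bar> \<le> real (length v)" for k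
    using occurrences_cyclic_occurrences[of v "w ^ k"]
    by (simp add: power_list cyclic_occurrences_power counting_list_def cyclic_counting_list_def)
qed

section \<open>Free groups\<close>

lemma occurrences_push:
  "\<bar>real (occurrences v (push x w)) - real (occurrences v w)\<bar> \<le> 1"
proof (cases w)
  case Nil
  then show ?thesis using occurrences_Cons[of v "[]" x] by (simp add: push_def)
next
  case (Cons y ys)
  then show ?thesis
    using occurrences_Cons[of v w x] occurrences_Cons[of v ys y] by (auto simp: push_def)
qed

lemma occurrences_mult_left:
  "\<bar>counting v (g * h) - counting v h\<bar> \<le> real (length (word_of g))" for g h :: "'a free_group"
proof -
  have "\<bar>real (occurrences u (foldr push x w)) - real (occurrences u w)\<bar> \<le> real (length x)"
    for u x w :: "('a \<times> bool) list"
  proof (induction x)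
    case Nil
    then show ?case by simp
  next
    case (Cons s x)
    then show ?case using occurrences_push[of u s "foldr push x w"] by simp
  qed
  then show ?thesis
    using word_of[of h]
    by (simp add: counting_free_group_def times_free_group.rep_eq reduce_append reduce_reduced)
qed

lemma reduce_snoc:
  assumes "reduced w"
  shows "reduce (w @ [x]) = (if w \<noteq> [] \<and> last w = inv_letter x then butlast w else w @ [x])"
proof (cases "w \<noteq> [] \<and> last w = inv_letter x")
  case True
  then obtain u where u: "w = u @ [inv_letter x]"
    by (metis append_butlast_last_id)
  then have "reduced u"
    using assms by (auto simp: reduced_def successively_append_iff)
  then have "reduce (u @ []) = u"
    by (simp add: reduce_reduced)
  moreover have "reduce [inv_letter x, x] = reduce []"
    by (simp add: reduce_def push_def)
  ultimately have "reduce (w @ [x]) = u"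
    using reduce_reduce_append2[of u "[inv_letter x, x]"] by (simp add: u reduce_def)
  then show ?thesis using True u by simp
next
  case False
  then have "reduced (w @ [x])"
    using assms by (auto simp: reduced_def successively_append_iff)
  then show ?thesis using False by (auto simp: reduce_reduced)
qed

lemma occurrences_mult_right:
  "\<bar>counting v (h * g) - counting v h\<bar> \<le> real (length (word_of g))" for g h :: "'a free_group"
proof -
  have "\<bar>real (occurrences u (reduce (w @ x))) - real (occurrences u w)\<bar> \<le> real (length x)"
    if "reduced w" for u x w :: "('a \<times> bool) list"
    using that
  proof (induction x arbitrary: w)
    case Nil
    then show ?case by (simp add: reduce_reduced)
  next
    case (Cons s x)
    have "\<bar>real (occurrences u (reduce (w @ [s]))) - real (occurrences u w)\<bar> \<le> 1"
    proof (cases "w \<noteq> [] \<and> last w = inv_letter s")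
      case True
      then have "butlast w @ [inv_letter s] = w"
        by (metis append_butlast_last_id)
      then show ?thesis
        using occurrences_snoc[of u "butlast w" "inv_letter s"] True
        by (simp add: reduce_snoc[OF Cons.prems])
    next
      case False
      then show ?thesis
        using occurrences_snoc[of u w s] by (auto simp: reduce_snoc[OF Cons.prems])
    qed
    moreover have "reduce (reduce (w @ [s]) @ x) = reduce (w @ s # x)"
      by (simp add: reduce_reduce_append1)
    ultimately show ?case
      using Cons.IH[of "reduce (w @ [s])"] by simp
  qed
  then show ?thesis
    using word_of[of h] by (simp add: counting_free_group_def times_free_group.rep_eq)
qed

text \<open>No cancellation occurs between consecutive copies of a cyclically reduced word.\<close>

lemma word_of_power:
  assumes "cyclically_reduced h"
  shows "word_of (h ^ k) = concat (replicate k (word_of h))"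
proof (cases "word_of h = []")
  case True
  have "word_of (h ^ k) = []"
    by (induction k) (simp_all add: one_free_group.rep_eq times_free_group.rep_eq True reduce_def)
  then show ?thesis using True by simp
next
  case False
  let ?w = "word_of h"
  have red: "reduced (concat (replicate k ?w))" for k
  proof (induction k)
    case 0
    then show ?case by simp
  next
    case (Suc k)
    then show ?case
      using assms False word_of[of h]
      by (cases k) (auto simp: reduced_def successively_append_iff cyclically_reduced_def)
  qed
  show ?thesis
  proof (induction k)
    case 0
    then show ?case by (simp add: one_free_group.rep_eq)
  next
    case (Suc k)
    then show ?case
      using red[of "Suc k"] by (simp add: times_free_group.rep_eq reduce_reduced)
  qed
qed

lemma free_group_right_inverse: "g * inverse g = (1 :: 'a free_group)"
  by (metis free_group_left_inverse mult.assoc mult_1_left)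

lemma conjugate_power:
  assumes "h = inverse x * g * x"
  shows "g ^ k = x * h ^ k * inverse (x :: 'a free_group)"
proof (induction k)
  case 0
  then show ?case by (simp add: free_group_right_inverse)
next
  case (Suc k)
  have "x * h = (x * inverse x) * (g * x)"
    by (simp only: assms mult.assoc)
  then have xh: "x * h = g * x"
    by (simp add: free_group_right_inverse)
  have "g ^ Suc k = (g * x) * h ^ k * inverse x"
    using Suc by (simp add: mult.assoc)
  also have "\<dots> = x * h ^ Suc k * inverse x"
    by (simp add: mult.assoc flip: xh)
  finally show ?case .
qed

text \<open>Passing from \<open>g ^ k\<close> to \<open>h ^ k\<close> costs a bounded number of occurrences, since the conjugating
  element is the same for all \<open>k\<close>, and the cyclic count of \<open>h ^ k\<close> is exactly \<open>k\<close> times that of \<open>h\<close>.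
  As the limit depends on \<open>g\<close> only, all cyclically reduced conjugates of \<open>g\<close> have the same cyclic
  counts as the one chosen by \<open>cyclic_core\<close>.\<close>

lemma tendsto_counting_conjugate:
  fixes g h v :: "'a free_group"
  assumes "cyclically_reduced h" "conjugate g h"
  shows "(\<lambda>k. counting v (g ^ k) / real k)
    \<longlonglongrightarrow> real (cyclic_occurrences (word_of v) (word_of h))"
proof -
  obtain x where x: "h = inverse x * g * x"
    using assms(2) by (auto simp: conjugate_def)
  show ?thesis
  proof (rule tendsto_slope)
    fix k
    have "\<bar>counting v (g ^ k) - counting v (x * h ^ k)\<bar> \<le> real (length (word_of (inverse x)))"
      unfolding conjugate_power[OF x] by (rule occurrences_mult_right)
    moreover have "\<bar>counting v (x * h ^ k) - counting v (h ^ k)\<bar> \<le> real (length (word_of x))"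
      by (rule occurrences_mult_left)
    moreover have "\<bar>counting v (h ^ k) -
        real k * real (cyclic_occurrences (word_of v) (word_of h))\<bar> \<le> real (length (word_of v))"
      using occurrences_cyclic_occurrences[of "word_of v" "word_of (h ^ k)"]
      by (simp add: counting_free_group_def word_of_power[OF assms(1)] cyclic_occurrences_power)
    ultimately show "\<bar>counting v (g ^ k) -
        real k * real (cyclic_occurrences (word_of v) (word_of h))\<bar>
      \<le> real (length (word_of (inverse x))) + real (length (word_of x))
        + real (length (word_of v))"
      by linarith
  qed
qed

lemma tendsto_counting_free_group:
  "(\<lambda>k. counting v (g ^ k) / real k) \<longlonglongrightarrow> cyclic_counting v g" for v g :: "'a free_group"
proof -
  have "cyclically_reduced (cyclic_core g) \<and> conjugate g (cyclic_core g)"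
    unfolding cyclic_core_def by (rule someI_ex) (rule ex_cyclically_reduced_conjugate)
  then show ?thesis
    unfolding cyclic_counting_free_group_def by (intro tendsto_counting_conjugate) auto
qed

lemma cyclic_counting_cyclically_reduced:
  assumes "cyclically_reduced g"
  shows "cyclic_counting v g = real (cyclic_occurrences (word_of v) (word_of g))"
proof -
  have "g = inverse 1 * g * 1"
    using free_group_left_inverse[of "1 :: 'a free_group"] by simp
  then have "conjugate g g"
    unfolding conjugate_def by blast
  then show ?thesis
    using LIMSEQ_unique[OF tendsto_counting_free_group tendsto_counting_conjugate[OF assms]] by blast
qed

text \<open>The appended letter must avoid the inverses of the first and of the last letter of the word;
  with two generators there are at least four letters to choose from.\<close>

lemma ex_cyclically_reduced_mult:
  fixes g :: "'a::finite free_group"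
  assumes "CARD('a) \<ge> 2"
  shows "\<exists>s. cyclically_reduced (g * s) \<and> length (word_of s) = 1"
proof -
  define w where "w = word_of g"
  let ?E = "{inv_letter (hd w), inv_letter (last w)}"
  have "card ?E < CARD('a \<times> bool)"
    using assms card_insert_le_m1[of 2 "{inv_letter (last w)}" "inv_letter (hd w)"] by simp
  then have "?E \<noteq> UNIV"
    by (metis less_irrefl)
  then obtain x where x: "x \<notin> ?E" by blast
  define s where "s = Abs_free_group [x]"
  have ws: "word_of s = [x]"
    by (simp add: s_def Abs_free_group_inverse reduced_def)
  have red: "reduced w"
    using word_of[of g] by (simp add: w_def)
  have "last w \<noteq> inv_letter x" "hd w \<noteq> inv_letter x"
    using x by auto
  then have "word_of (g * s) = w @ [x]"
    using red by (simp add: times_free_group.rep_eq ws reduce_snoc flip: w_def)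
  then have "cyclically_reduced (g * s)"
    using \<open>hd w \<noteq> inv_letter x\<close> by (cases w) (auto simp: cyclically_reduced_def)
  then show ?thesis using ws by auto
qed

section \<open>The isomorphisms\<close>

theorem theoremA6:
  assumes "CARD('a::finite) \<ge> 2"
  shows
    "(\<forall>f \<in> (counting_space :: ('a list \<Rightarrow> real) set).
        homogenizable f \<and> homogenization_map (counting_class f) = homogenization f)
     \<and> linear (homogenization_map :: 'a list counting_quotient \<Rightarrow> 'a list \<Rightarrow> real)
     \<and> bij_betw (homogenization_map :: 'a list counting_quotient \<Rightarrow> 'a list \<Rightarrow> real)
         UNIV cyclic_counting_space
     \<and> (\<forall>f \<in> (counting_space :: ('a free_group \<Rightarrow> real) set).
        homogenizable f \<and> homogenization_map (counting_class f) = homogenization f)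
     \<and> linear (homogenization_map :: 'a free_group counting_quotient \<Rightarrow> 'a free_group \<Rightarrow> real)
     \<and> bij_betw (homogenization_map :: 'a free_group counting_quotient \<Rightarrow> 'a free_group \<Rightarrow> real)
         UNIV cyclic_counting_space"
proof -
  have close_list: "\<exists>K. \<forall>w :: 'a list. \<bar>counting v w - cyclic_counting v (id w)\<bar> \<le> K"
    for v :: "'a list"
    using occurrences_cyclic_occurrences[of v]
    by (auto simp: counting_list_def cyclic_counting_list_def)
  obtain s :: "'a free_group \<Rightarrow> 'a free_group"
    where s: "cyclically_reduced (g * s g)" "length (word_of (s g)) = 1" for g
    using ex_cyclically_reduced_mult[OF assms] by metis
  have "\<bar>counting v g - cyclic_counting v (g * s g)\<bar> \<le> real (length (word_of v)) + 1"
    for v g :: "'a free_group"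
  proof -
    have "\<bar>counting v (g * s g) - counting v g\<bar> \<le> 1"
      using occurrences_mult_right[of v g "s g"] s(2)[of g] by simp
    moreover have "\<bar>counting v (g * s g) - cyclic_counting v (g * s g)\<bar>
        \<le> real (length (word_of v))"
      unfolding cyclic_counting_cyclically_reduced[OF s(1)] counting_free_group_def
      by (rule occurrences_cyclic_occurrences)
    ultimately show ?thesis by linarith
  qed
  then have close_group:
    "\<exists>K. \<forall>g :: 'a free_group. \<bar>counting v g - cyclic_counting v (g * s g)\<bar> \<le> K"
    for v :: "'a free_group"
    by blast
  show ?thesis
    using homogenization_map_iso[OF tendsto_counting_list close_list]
      homogenization_map_iso[OF tendsto_counting_free_group close_group]
    by simp
qed

end
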